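(* Let $X_1$, $X_2$ be visual Gromov hyperbolic spaces, let their boundaries at infinity $\partial_\infty X_1$, $\partial_\infty X_2$ be taken with some visual metrics, and let $k\ge 0$ be an integer. Assume that the metric spaces of the family $\{a\,\partial_\infty X_1\times b\,\partial_\infty X_2 : a\ge 1,\ b\ge 1\}$ have linearly controlled dimension $\operatorname{\ell-dim}\le k$ uniformly. Then $$\operatorname{asdim}(X_1\times X_2)\le k+2.$$
   Context: Products of metric spaces carry the $l_\infty$-metric $|(x,y)(x',y')|=\max\{|xx'|,|yy'|\}$. For a metric space $X$ and $a>0$, $aX$ denotes $X$ with all distances multiplied by $a$. Hyperbolicity. For $o,x,x'$ in a metric space $X$, the Gromov product is $(x|x')_o=\frac12(|xo|+|x'o|-|xx'|)$. $X$ is $\delta$-hyperbolic if $(x|y)_o\ge\min\{(x|z)_o,(z|y)_o\}-\delta$ for all $o,x,y,z\in X$; it is (Gromov) hyperbolic if it is $\delta$-hyperbolic for some $\delta\ge0$. $\partial_\infty X$ is the Gromov boundary at infinity; the Gromov product based at $o$ extends in the standard way to $\partial_\infty X$. A metric $d$ on $\partial_\infty X$ is visual if there are $o\in X$, $a>1$ and constants $c_1,c_2>0$ with $c_1a^{-(\xi|\xi')_o}\le d(\xi,\xi')\le c_2a^{-(\xi|\xi')_o}$ for all $\xi,\xi'\in\partial_\infty X$. A hyperbolic space $X$ is visual if for some base point $x_0\in X$ there is $D>0$ such that for every $x\in X$ there is $\xi\in\partial_\infty X$ with $|xx_0|\le(x|\xi)_{x_0}+D$. Coverings. For a family $\mathcal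 U$ of subsets of a metric space $Z$: $\operatorname{mesh}(\mathcal U)=\sup\{\operatorname{diam}U:U\in\mathcal U\}$; the multiplicity $m(\mathcal U)$ is the maximal number of members of $\mathcal U$ with nonempty intersection; $\mathcal U$ is disjoint if its members are pairwise disjoint; a covering is $m$-colored if it is the union of $m$ disjoint families. The Lebesgue number of an open covering $\mathcal U$ of $Z$ is $L(\mathcal U)=\inf_{z\in Z}\sup\{\operatorname{dist}(z,Z\setminus U):U\in\mathcal U\}$. Uniform linearly controlled dimension. Metric spaces $\{X_\alpha\}_{\alpha\in\mathcal A}$ have $\operatorname{\ell-dim}\le k$ uniformly if there is a constant $\delta\in(0,1)$ such that for every sufficiently small $\tau>0$ and every $\alpha\in\mathcal A$ there is a $(k+1)$-colored open covering $\mathcal U_\alpha$ of $X_\alpha$ with $\operatorname{mesh}(\mathcal U_\alpha)\le\tau$ and $L(\mathcal U_\alpha)\ge\delta\tau$ (the bound on $\tau$ does not depend on $\alpha$). Asymptotic dimension. $\operatorname{asdim}X$ is the minimal integer $m\ge0$ such that for every $d>0$ there is an open covering $\mathcal U$ of $X$ with $m(\mathcal U)\le m+1$, $\operatorname{mesh}(\mathcal U)<\infty$ and $L(\mathcal U)\ge d$ ($\infty$ if no such $m$ exists). *)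

theory Defs
  imports "HOL-Analysis.Analysis"
begin

text \<open>Metric spaces are elements of the library type of bundled metrics
  (carrier \<^const>\<open>mspace\<close>, distance \<^const>\<open>mdist\<close>), so that scaled copies, products and
  boundaries at infinity are all objects of the same kind.\<close>

definition scale_metric :: "real \<Rightarrow> 'a metric \<Rightarrow> 'a metric" where
  "scale_metric a X = metric (mspace X, \<lambda>x y. a * mdist X x y)"

text \<open>The library's \<^const>\<open>prod_metric\<close> is the Euclidean product, hence the following.\<close>

definition linf_prod :: "'a metric \<Rightarrow> 'b metric \<Rightarrow> ('a \<times> 'b) metric" where
  "linf_prod X Y = metric (mspace X \<times> mspace Y,
     \<lambda>(x, y) (x', y'). max (mdist X x x') (mdist Y y y'))"

lemma Metric_space_scale:
  assumes "a > 0"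
  shows "Metric_space (mspace X) (\<lambda>x y. a * mdist X x y)"
proof
  show "0 \<le> a * mdist X x y" for x y using assms by simp
  show "a * mdist X x y = a * mdist X y x" for x y by (simp add: mdist_commute)
  show "a * mdist X x y = 0 \<longleftrightarrow> x = y" if "x \<in> mspace X" "y \<in> mspace X" for x y
    using assms that by simp
  show "a * mdist X x z \<le> a * mdist X x y + a * mdist X y z"
    if "x \<in> mspace X" "y \<in> mspace X" "z \<in> mspace X" for x y z
    using assms mdist_triangle[OF that] by (simp flip: distrib_left)
qed

lemma
  assumes "a > 0"
  shows mspace_scale_metric: "mspace (scale_metric a X) = mspace X"
    and mdist_scale_metric: "mdist (scale_metric a X) = (\<lambda>x y. a * mdist X x y)"
  using Metric_space_scale[OF assms, of X]
  by (auto simp: scale_metric_def Metric_space.mspace_metric Metric_space.mdist_metric)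

lemma Metric_space_linf_prod:
  "Metric_space (mspace X \<times> mspace Y) (\<lambda>(x, y) (x', y'). max (mdist X x x') (mdist Y y y'))"
proof (unfold_locales, goal_cases)
  case (1 p q)
  then show ?case by (auto simp: max_def split: prod.split)
next
  case (2 p q)
  then show ?case by (auto simp: mdist_commute split: prod.split)
next
  case (3 p q)
  obtain x y x' y' where p: "p = (x, y)" "q = (x', y')"
    by (metis surj_pair)
  have "max (mdist X x x') (mdist Y y y') = 0 \<longleftrightarrow> mdist X x x' = 0 \<and> mdist Y y y' = 0"
    using mdist_nonneg[of X x x'] mdist_nonneg[of Y y y'] by linarith
  with 3 show ?case by (simp add: p)
next
  case (4 p q r)
  obtain x y x' y' x'' y'' where p: "p = (x, y)" "q = (x', y')" "r = (x'', y'')"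
    by (metis surj_pair)
  with 4 have "mdist X x x'' \<le> mdist X x x' + mdist X x' x''"
    and "mdist Y y y'' \<le> mdist Y y y' + mdist Y y' y''"
    by (auto intro: mdist_triangle)
  then show ?case by (auto simp: p)
qed

lemma
  shows mspace_linf_prod: "mspace (linf_prod X Y) = mspace X \<times> mspace Y"
    and mdist_linf_prod:
      "mdist (linf_prod X Y) = (\<lambda>(x, y) (x', y'). max (mdist X x x') (mdist Y y y'))"
  using Metric_space_linf_prod[of X Y]
  by (auto simp: linf_prod_def Metric_space.mspace_metric Metric_space.mdist_metric)


section \<open>Gromov hyperbolic spaces\<close>

text \<open>\<open>gromov_product X p x y\<close> is the Gromov product of \<open>x\<close> and \<open>y\<close> based at \<open>p\<close>.\<close>

definition gromov_product :: "'a metric \<Rightarrow> 'a \<Rightarrow> 'a \<Rightarrow> 'a \<Rightarrow> real" where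
  "gromov_product X p x y = (mdist X x p + mdist X y p - mdist X x y) / 2"

definition delta_hyperbolic :: "real \<Rightarrow> 'a metric \<Rightarrow> bool" where
  "delta_hyperbolic \<delta> X \<longleftrightarrow>
     (\<forall>p\<in>mspace X. \<forall>x\<in>mspace X. \<forall>y\<in>mspace X. \<forall>z\<in>mspace X.
        gromov_product X p x y \<ge> min (gromov_product X p x z) (gromov_product X p z y) - \<delta>)"

definition gromov_hyperbolic :: "'a metric \<Rightarrow> bool" where
  "gromov_hyperbolic X \<longleftrightarrow> (\<exists>\<delta>\<ge>0. delta_hyperbolic \<delta> X)"

text \<open>Points at infinity are equivalence classes of sequences converging to infinity. The
  conditions do not depend on the base point, so quantifying over all base points is harmless.\<close>

definition converges_to_infinity :: "'a metric \<Rightarrow> (nat \<Rightarrow> 'a) \<Rightarrow> bool" where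
  "converges_to_infinity X u \<longleftrightarrow> range u \<subseteq> mspace X \<and>
     (\<forall>p\<in>mspace X. filterlim (\<lambda>(i, j). gromov_product X p (u i) (u j)) at_top
                     (sequentially \<times>\<^sub>F sequentially))"

definition infinity_rel :: "'a metric \<Rightarrow> ((nat \<Rightarrow> 'a) \<times> (nat \<Rightarrow> 'a)) set" where
  "infinity_rel X = {(u, v). converges_to_infinity X u \<and> converges_to_infinity X v \<and>
     (\<forall>p\<in>mspace X. filterlim (\<lambda>i. gromov_product X p (u i) (v i)) at_top sequentially)}"

definition gromov_boundary :: "'a metric \<Rightarrow> (nat \<Rightarrow> 'a) set set" where
  "gromov_boundary X = {u. converges_to_infinity X u} // infinity_rel X"

lemma equiv_infinity_rel:
  assumes "gromov_hyperbolic X"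
  shows "equiv {u. converges_to_infinity X u} (infinity_rel X)"
proof (rule equivI)
  show "infinity_rel X \<subseteq> {u. converges_to_infinity X u} \<times> {u. converges_to_infinity X u}"
    by (auto simp: infinity_rel_def)
  show "refl_on {u. converges_to_infinity X u} (infinity_rel X)"
  proof (rule refl_onI)
    fix u assume "u \<in> {u. converges_to_infinity X u}"
    then have u: "converges_to_infinity X u" by simp
    have "filterlim (\<lambda>i. gromov_product X p (u i) (u i)) at_top sequentially"
      if "p \<in> mspace X" for p
    proof -
      have "filterlim (\<lambda>i::nat. (i, i)) (sequentially \<times>\<^sub>F sequentially) sequentially"
        by (intro filterlim_Pair filterlim_ident)
      from filterlim_compose[OF _ this, of "\<lambda>(i, j). gromov_product X p (u i) (u j)"]
      show ?thesis using u that by (auto simp: converges_to_infinity_def)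
    qed
    with u show "(u, u) \<in> infinity_rel X" by (auto simp: infinity_rel_def)
  qed
  show "sym (infinity_rel X)"
    by (auto simp: sym_def infinity_rel_def gromov_product_def mdist_commute add.commute)
  show "trans (infinity_rel X)"
  proof (rule transI)
    fix u v w assume uv: "(u, v) \<in> infinity_rel X" and vw: "(v, w) \<in> infinity_rel X"
    obtain \<delta> where \<delta>: "delta_hyperbolic \<delta> X"
      using assms by (auto simp: gromov_hyperbolic_def)
    have "filterlim (\<lambda>i. gromov_product X p (u i) (w i)) at_top sequentially"
      if p: "p \<in> mspace X" for p
      unfolding filterlim_at_top
    proof
      fix Z :: real
      have 1: "\<forall>\<^sub>F i in sequentially. Z + \<delta> \<le> gromov_product X p (u i) (v i)"
        and 2: "\<forall>\<^sub>F i in sequentially. Z + \<delta> \<le> gromov_product X p (v i) (w i)"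
        using uv vw p by (auto simp: infinity_rel_def filterlim_at_top)
      show "\<forall>\<^sub>F i in sequentially. Z \<le> gromov_product X p (u i) (w i)"
        using 1 2
      proof eventually_elim
        case (elim i)
        have "u i \<in> mspace X" "v i \<in> mspace X" "w i \<in> mspace X"
          using uv vw by (auto simp: infinity_rel_def converges_to_infinity_def)
        then have "gromov_product X p (u i) (w i) \<ge>
            min (gromov_product X p (u i) (v i)) (gromov_product X p (v i) (w i)) - \<delta>"
          using \<delta> p by (auto simp: delta_hyperbolic_def)
        with elim show ?case by linarith
      qed
    qed
    with uv vw show "(u, w) \<in> infinity_rel X" by (auto simp: infinity_rel_def)
  qed
qed

text \<open>Extension of the Gromov product to the boundary: infimum of the lower limits over all
  representing sequences. The value is \<open>\<infinity>\<close> for two equal points at infinity.\<close>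

definition gromov_product_bdry ::
    "'a metric \<Rightarrow> 'a \<Rightarrow> (nat \<Rightarrow> 'a) set \<Rightarrow> (nat \<Rightarrow> 'a) set \<Rightarrow> ereal" where
  "gromov_product_bdry X p \<xi> \<eta> =
     (INF (u, v)\<in>\<xi> \<times> \<eta>. liminf (\<lambda>i. ereal (gromov_product X p (u i) (v i))))"

definition gromov_product_mixed :: "'a metric \<Rightarrow> 'a \<Rightarrow> 'a \<Rightarrow> (nat \<Rightarrow> 'a) set \<Rightarrow> ereal" where
  "gromov_product_mixed X p x \<xi> =
     (INF u\<in>\<xi>. liminf (\<lambda>i. ereal (gromov_product X p x (u i))))"

text \<open>\<open>a\<close> to the power \<open>-t\<close>, with value 0 at \<open>t = \<infinity>\<close>.\<close>

definition neg_powr :: "real \<Rightarrow> ereal \<Rightarrow> real" where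
  "neg_powr a t = (if t = \<infinity> then 0 else a powr (- real_of_ereal t))"

definition visual_metric :: "'a metric \<Rightarrow> (nat \<Rightarrow> 'a) set metric \<Rightarrow> bool" where
  "visual_metric X B \<longleftrightarrow> mspace B = gromov_boundary X \<and>
     (\<exists>p\<in>mspace X. \<exists>a>1. \<exists>c1>0. \<exists>c2>0.
        \<forall>\<xi>\<in>gromov_boundary X. \<forall>\<eta>\<in>gromov_boundary X.
          c1 * neg_powr a (gromov_product_bdry X p \<xi> \<eta>) \<le> mdist B \<xi> \<eta> \<and>
          mdist B \<xi> \<eta> \<le> c2 * neg_powr a (gromov_product_bdry X p \<xi> \<eta>))"

definition visual_hyperbolic :: "'a metric \<Rightarrow> bool" where
  "visual_hyperbolic X \<longleftrightarrow> gromov_hyperbolic X \<and>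
     (\<exists>p\<in>mspace X. \<exists>D>0. \<forall>x\<in>mspace X. \<exists>\<xi>\<in>gromov_boundary X.
        ereal (mdist X x p) \<le> gromov_product_mixed X p x \<xi> + ereal D)"


section \<open>Coverings and dimensions\<close>

definition open_covering :: "'a metric \<Rightarrow> 'a set set \<Rightarrow> bool" where
  "open_covering X \<U> \<longleftrightarrow> (\<forall>U\<in>\<U>. openin (mtopology_of X) U) \<and> \<Union>\<U> = mspace X"

text \<open>Suprema and infima of distances are taken in \<^typ>\<open>ennreal\<close>; the empty set has
  diameter 0, and the distance of a point to the empty set is \<open>\<infinity>\<close>.\<close>

definition mesh :: "'a metric \<Rightarrow> 'a set set \<Rightarrow> ennreal" where
  "mesh X \<U> = (SUP U\<in>\<U>. SUP x\<in>U. SUP y\<in>U. ennreal (mdist X x y))"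

definition lebesgue_num :: "'a metric \<Rightarrow> 'a set set \<Rightarrow> ennreal" where
  "lebesgue_num X \<U> =
     (INF z\<in>mspace X. SUP U\<in>\<U>. INF w\<in>mspace X - U. ennreal (mdist X z w))"

definition multiplicity_cov :: "'a set set \<Rightarrow> enat" where
  "multiplicity_cov \<U> = (SUP \<F>\<in>{\<F>. \<F> \<subseteq> \<U> \<and> finite \<F> \<and> \<Inter>\<F> \<noteq> {}}. enat (card \<F>))"

definition colored :: "nat \<Rightarrow> 'a set set \<Rightarrow> bool" where
  "colored m \<U> \<longleftrightarrow> (\<exists>\<C> :: nat \<Rightarrow> 'a set set. (\<forall>i<m. pairwise disjnt (\<C> i)) \<and> \<U> = (\<Union>i<m. \<C> i))"

definition uniform_ldim_le :: "'a metric set \<Rightarrow> nat \<Rightarrow> bool" where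
  "uniform_ldim_le \<X> k \<longleftrightarrow>
     (\<exists>\<delta>::real. 0 < \<delta> \<and> \<delta> < 1 \<and>
        (\<forall>\<^sub>F \<tau> in at_right 0. \<forall>X\<in>\<X>. \<exists>\<U>. open_covering X \<U> \<and> colored (k + 1) \<U> \<and>
           mesh X \<U> \<le> ennreal \<tau> \<and> lebesgue_num X \<U> \<ge> ennreal (\<delta> * \<tau>)))"

definition asdim :: "'a metric \<Rightarrow> enat" where
  "asdim X = Inf {enat m | m. \<forall>d::real>0. \<exists>\<U>. open_covering X \<U> \<and>
     multiplicity_cov \<U> \<le> enat (m + 1) \<and> mesh X \<U> < \<infinity> \<and> lebesgue_num X \<U> \<ge> ennreal d}"

end

theory Submission
  imports Defs
begin

text \<open>
  For a fixed window size, consider the points \<open>(x1, x2)\<close> of \<open>X1 \<times> X2\<close> whose heights, that is,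
  distances to base points \<open>p1\<close> and \<open>p2\<close>, lie in given intervals \<open>{c..c + L}\<close> and \<open>{d..d + L'}\<close>.
  Since \<open>X1\<close> is visual, each point has a shadow on \<open>\<partial>X1\<close>, and at height about \<open>c\<close> the space \<open>X1\<close>
  looks coarsely like \<open>\<partial>X1\<close> magnified by \<open>a powr c\<close>: points at bounded distance have shadows at
  bounded magnified distance, and conversely (\<open>shadow_maps_at_height\<close>). At low heights,
  where the factor would have to be below 1, the space is bounded and a constant map does as well.
  So all these windows map to members of the family \<open>s \<partial>X1 \<times> t \<partial>X2\<close> with \<open>s, t \<ge> 1\<close>, and the
  constants are the same for all of them. The coloured coverings
  of that family pull back, and the windows have asymptotic dimension at most \<open>k\<close>, uniformly.

  The two height functions are 1-Lipschitz maps to the line. A Hurewicz theorem over the line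
  (\<open>uniform_asdim_le_fibration\<close>) says that a space has dimension at most \<open>n + 1\<close> if, for each
  \<open>L\<close>, the preimages of intervals of length \<open>L\<close> have dimension at most \<open>n\<close> uniformly. Two
  applications, one for each height, give \<open>k + 2\<close>.

  Dimension at most \<open>n\<close> is used in the form that at each scale \<open>r\<close> there are \<open>n + 1\<close> sets covering
  the space whose \<open>r\<close>-components are uniformly bounded. This form is convenient because a union of
  sets stays good if each set is good at a scale much larger than the bounds of the previous ones
  (\<open>components_bounded_Un\<close>). Only at the end is it turned into open coverings, by taking
  neighbourhoods of components.
\<close>

section \<open>Coarse components\<close>

definition steps :: "'a metric \<Rightarrow> real \<Rightarrow> 'a set \<Rightarrow> ('a \<times> 'a) set" where
  "steps M r A = {(x, y). x \<in> A \<and> y \<in> A \<and> mdist M x y \<le> r}"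

definition components_bounded :: "'a metric \<Rightarrow> real \<Rightarrow> real \<Rightarrow> 'a set \<Rightarrow> bool" where
  "components_bounded M r R A \<longleftrightarrow> (\<forall>x\<in>A. \<forall>y. (x, y) \<in> (steps M r A)\<^sup>* \<longrightarrow> mdist M x y \<le> R)"

lemma components_boundedD:
  "components_bounded M r R A \<Longrightarrow> x \<in> A \<Longrightarrow> (x, y) \<in> (steps M r A)\<^sup>* \<Longrightarrow> mdist M x y \<le> R"
  by (auto simp: components_bounded_def)

lemma chain_end_in:
  assumes "(x, y) \<in> (steps M r A)\<^sup>*" "x \<in> A"
  shows "y \<in> A"
  using assms by (induction rule: rtrancl_induct) (auto simp: steps_def)

lemma sym_steps: "sym (steps M r A)"
  by (auto simp: sym_def steps_def mdist_commute)

lemma chain_sym: "(x, y) \<in> (steps M r A)\<^sup>* \<Longrightarrow> (y, x) \<in> (steps M r A)\<^sup>*"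
  by (meson sym_rtrancl sym_steps symD)

text \<open>A chain in the union consists of stretches in \<open>A\<close>, which move by at most \<open>D\<close>, between visits to
  \<open>B\<close>. Consecutive visits to \<open>B\<close> are therefore at distance at most \<open>D + 2 * r\<close>, and so all of them
  lie in one \<open>(D + 2 * r)\<close>-component of \<open>B\<close>.\<close>

lemma components_bounded_Un:
  assumes AM: "A \<subseteq> mspace M" and BM: "B \<subseteq> mspace M"
    and A: "components_bounded M r D A" and B: "components_bounded M (D + 2 * r) R B"
    and nn: "0 \<le> r" "0 \<le> D" "0 \<le> R"
  shows "components_bounded M r (R + 2 * (D + r)) (A \<union> B)"
  unfolding components_bounded_def
proof (intro ballI allI impI)
  fix x y assume x: "x \<in> A \<union> B" and xy: "(x, y) \<in> (steps M r (A \<union> B))\<^sup>*"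
  define inA where "inA y \<longleftrightarrow> x \<in> A \<and> (x, y) \<in> (steps M r A)\<^sup>*" for y
  define near where "near b y \<longleftrightarrow> y = b \<or> (\<exists>a\<in>A. mdist M b a \<le> r \<and> (a, y) \<in> (steps M r A)\<^sup>*)"
    for b y
  define inB where "inB y \<longleftrightarrow> (\<exists>b0\<in>B. \<exists>b\<in>B. mdist M x b0 \<le> D + r \<and>
      (b0, b) \<in> (steps M (D + 2 * r) B)\<^sup>* \<and> near b y)" for y
  have near_le: "mdist M b y \<le> D + r" if "b \<in> B" "near b y" for b y
    using that(2) unfolding near_def
  proof
    assume "y = b"
    moreover have "mdist M b b = 0" using that BM by auto
    ultimately show ?thesis using nn by simp
  next
    assume "\<exists>a\<in>A. mdist M b a \<le> r \<and> (a, y) \<in> (steps M r A)\<^sup>*"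
    then obtain a where a: "a \<in> A" "mdist M b a \<le> r" "(a, y) \<in> (steps M r A)\<^sup>*" by auto
    have "mdist M b y \<le> mdist M b a + mdist M a y"
      using a chain_end_in[OF a(3,1)] that AM BM by (intro mdist_triangle) auto
    then show ?thesis using a components_boundedD[OF A a(1,3)] by linarith
  qed
  \<comment> \<open>Either no visit to \<open>B\<close> so far, or \<open>b0\<close> and \<open>b\<close> are the first and the latest visits.\<close>
  from xy have "y \<in> A \<union> B \<and> (inA y \<or> inB y)"
  proof (induction rule: rtrancl_induct)
    case base
    show ?case
    proof (cases "x \<in> A")
      case True then show ?thesis by (auto simp: inA_def)
    next
      case False
      then have "x \<in> B" using x by auto
      moreover have "x \<in> mspace M" using x AM BM by auto
      then have "mdist M x x = 0" by simp
      then have "mdist M x x \<le> D + r" using nn by simp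
      ultimately show ?thesis unfolding inB_def near_def by blast
    qed
  next
    case (step y z)
    have z: "y \<in> A \<union> B" "z \<in> A \<union> B" "mdist M y z \<le> r" using step by (auto simp: steps_def)
    have mem: "x \<in> mspace M" "y \<in> mspace M" "z \<in> mspace M" using x z AM BM by auto
    from step.IH have "inA y \<or> inB y" by auto
    then have "inA z \<or> inB z"
    proof
      assume y: "inA y"
      then have yA: "y \<in> A" by (auto simp: inA_def intro: chain_end_in)
      show ?thesis
      proof (cases "z \<in> A")
        case True
        then have "(y, z) \<in> steps M r A" using z yA by (auto simp: steps_def)
        then show ?thesis using y by (auto simp: inA_def)
      next
        case False
        then have "z \<in> B" using z by auto
        moreover have "mdist M x z \<le> D + r"
          using mdist_triangle[OF mem] components_boundedD[OF A, of x y] y z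
          by (auto simp: inA_def)
        ultimately show ?thesis unfolding inB_def near_def by blast
      qed
    next
      assume "inB y"
      then obtain b0 b where b: "b0 \<in> B" "b \<in> B" "mdist M x b0 \<le> D + r"
        "(b0, b) \<in> (steps M (D + 2 * r) B)\<^sup>*" "near b y" by (auto simp: inB_def)
      show ?thesis
      proof (cases "z \<in> B")
        case True
        have "mdist M b z \<le> D + 2 * r"
          using mdist_triangle[of b M y z] mem b BM near_le[OF b(2,5)] z by auto
        then have "(b, z) \<in> steps M (D + 2 * r) B" using True b by (auto simp: steps_def)
        then have "(b0, z) \<in> (steps M (D + 2 * r) B)\<^sup>*" using b(4) by auto
        then show ?thesis using b True by (auto simp: inB_def near_def)
      next
        case False
        then have zA: "z \<in> A" using z by auto
        from b(5) have "near b z" unfolding near_def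
        proof
          assume "y = b"
          then show "z = b \<or> (\<exists>a\<in>A. mdist M b a \<le> r \<and> (a, z) \<in> (steps M r A)\<^sup>*)"
            using zA z by auto
        next
          assume "\<exists>a\<in>A. mdist M b a \<le> r \<and> (a, y) \<in> (steps M r A)\<^sup>*"
          then obtain a where a: "a \<in> A" "mdist M b a \<le> r" "(a, y) \<in> (steps M r A)\<^sup>*" by auto
          have "(y, z) \<in> steps M r A"
            using chain_end_in[OF a(3,1)] zA z by (auto simp: steps_def)
          then have "(a, z) \<in> (steps M r A)\<^sup>*" using a by auto
          then show "z = b \<or> (\<exists>a\<in>A. mdist M b a \<le> r \<and> (a, z) \<in> (steps M r A)\<^sup>*)"
            using a by auto
        qed
        then show ?thesis using b by (auto simp: inB_def)
      qed
    qed
    with z show ?case by auto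
  qed
  then have y: "y \<in> A \<union> B" "inA y \<or> inB y" by auto
  from y(2) show "mdist M x y \<le> R + 2 * (D + r)"
  proof
    assume "inA y"
    then have "mdist M x y \<le> D" using components_boundedD[OF A] by (auto simp: inA_def)
    moreover have "0 \<le> R + D + 2 * r" using nn by simp
    ultimately show ?thesis by (simp add: algebra_simps)
  next
    assume "inB y"
    then obtain b0 b where b: "b0 \<in> B" "b \<in> B" "mdist M x b0 \<le> D + r"
      "(b0, b) \<in> (steps M (D + 2 * r) B)\<^sup>*" "near b y" by (auto simp: inB_def)
    have "mdist M x y \<le> mdist M x b0 + mdist M b0 y"
      using x y b AM BM by (intro mdist_triangle) auto
    moreover have "mdist M b0 y \<le> mdist M b0 b + mdist M b y"
      using x y b AM BM by (intro mdist_triangle) auto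
    ultimately show ?thesis
      using b(3) near_le[OF b(2,5)] components_boundedD[OF B b(1,4)]
      by (simp add: algebra_simps)
  qed
qed

text \<open>The bound that iterated use of \<open>components_bounded_Un\<close> gives, where \<open>Rf s\<close> bounds the components
  at scale \<open>s\<close> of each set. The set number \<open>l\<close> has to be good at the scale
  \<open>accumulated_bound Rf r l + 2 * r\<close>, which accounts for the \<open>l\<close> sets before it.\<close>

primrec accumulated_bound :: "(real \<Rightarrow> real) \<Rightarrow> real \<Rightarrow> nat \<Rightarrow> real" where
  "accumulated_bound Rf r 0 = 0"
| "accumulated_bound Rf r (Suc l) =
     Rf (accumulated_bound Rf r l + 2 * r) + 2 * (accumulated_bound Rf r l + r)"

lemma accumulated_bound_nonneg:
  assumes "\<And>s. 0 \<le> Rf s" "0 \<le> r"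
  shows "0 \<le> accumulated_bound Rf r l"
  by (induction l) (use assms in auto)

lemma components_bounded_UN:
  assumes Rf: "\<And>s. 0 \<le> Rf s" and r: "0 \<le> r"
    and sub: "\<And>j. j < l \<Longrightarrow> A j \<subseteq> mspace M"
    and A: "\<And>j. j < l \<Longrightarrow> components_bounded M (accumulated_bound Rf r j + 2 * r)
              (Rf (accumulated_bound Rf r j + 2 * r)) (A j)"
  shows "components_bounded M r (accumulated_bound Rf r l) (\<Union>j<l. A j)"
  using sub A
proof (induction l)
  case 0
  then show ?case by (simp add: components_bounded_def)
next
  case (Suc l)
  have "components_bounded M r (accumulated_bound Rf r (Suc l)) ((\<Union>j<l. A j) \<union> A l)"
    unfolding accumulated_bound.simps
    using Suc accumulated_bound_nonneg[of Rf r l, OF Rf r] Rf r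
    by (intro components_bounded_Un) (auto simp: UN_subset_iff)
  moreover have "(\<Union>j<l. A j) \<union> A l = (\<Union>j<Suc l. A j)" by (auto simp: less_Suc_eq)
  ultimately show ?case by simp
qed

section \<open>A Hurewicz theorem over the line\<close>

text \<open>Asymptotic dimension at most \<open>n\<close>, with constants common to all members of the family.\<close>

definition uniform_asdim_le :: "'a metric \<Rightarrow> 'a set set \<Rightarrow> nat \<Rightarrow> bool" where
  "uniform_asdim_le M \<E> n \<longleftrightarrow> (\<forall>r>0. \<exists>R. \<forall>E\<in>\<E>. \<exists>C.
     E = (\<Union>i\<le>n. C i) \<and> (\<forall>i\<le>n. components_bounded M r R (C i)))"

lemma uniform_asdim_le_imp_control:
  assumes "uniform_asdim_le M \<E> n"
  obtains Rf :: "real \<Rightarrow> real" where "\<And>r. 0 \<le> Rf r"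
    "\<And>r E. 0 < r \<Longrightarrow> E \<in> \<E> \<Longrightarrow>
       \<exists>C. E = (\<Union>i\<le>n. C i) \<and> (\<forall>i\<le>n. components_bounded M r (Rf r) (C i))"
proof -
  from assms have "\<forall>r. \<exists>R. r > 0 \<longrightarrow> (\<forall>E\<in>\<E>. \<exists>C.
     E = (\<Union>i\<le>n. C i) \<and> (\<forall>i\<le>n. components_bounded M r R (C i)))"
    by (auto simp: uniform_asdim_le_def)
  then obtain Rf where Rf: "\<And>r E. r > 0 \<Longrightarrow> E \<in> \<E> \<Longrightarrow> \<exists>C.
     E = (\<Union>i\<le>n. C i) \<and> (\<forall>i\<le>n. components_bounded M r (Rf r) (C i))"
    by metis
  show ?thesis
  proof (rule that[of "\<lambda>r. max 0 (Rf r)"])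
    fix r E assume "0 < (r::real)" "E \<in> \<E>"
    from Rf[OF this] obtain C where C: "E = (\<Union>i\<le>n. C i)"
      "\<forall>i\<le>n. components_bounded M r (Rf r) (C i)" by auto
    have "\<forall>i\<le>n. components_bounded M r (max 0 (Rf r)) (C i)"
      using C(2) by (fastforce simp: components_bounded_def le_max_iff_disj)
    with C(1) show "\<exists>C. E = (\<Union>i\<le>n. C i) \<and>
        (\<forall>i\<le>n. components_bounded M r (max 0 (Rf r)) (C i))"
      by blast
  qed auto
qed

lemma floor_div_step:
  fixes s t r :: real
  assumes "0 < r" "\<bar>s - t\<bar> \<le> r"
  shows "\<bar>\<lfloor>s / r\<rfloor> - \<lfloor>t / r\<rfloor>\<bar> \<le> 1"
proof -
  have "\<bar>s / r - t / r\<bar> \<le> 1"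
    using assms by (simp add: diff_divide_distrib[symmetric])
  then show ?thesis by linarith
qed

text \<open>The integers not congruent to \<open>i\<close> fall into blocks of \<open>m - 1\<close> consecutive ones, and a step of
  length at most 1 cannot jump over the missing number between two blocks.\<close>

lemma same_block:
  fixes q q' i m :: int
  assumes "0 < m" "\<bar>q - q'\<bar> \<le> 1" "q mod m \<noteq> i mod m" "q' mod m \<noteq> i mod m"
  shows "(q - i) div m = (q' - i) div m"
proof -
  have *: "(q - i) div m = (q' - i) div m"
    if "q' = q + 1" "q' mod m \<noteq> i mod m" for q q'
  proof -
    have "(q' - i) mod m \<noteq> 0"
      using that by (auto simp: mod_eq_dvd_iff dvd_eq_mod_eq_0)
    then have "(q - i + 1) mod m \<noteq> 0" using that by (simp add: algebra_simps)
    then have "(q - i) mod m + 1 \<noteq> m"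
      by (metis mod_add_left_eq mod_self)
    then have lt: "(q - i) mod m + 1 < m"
      using assms(1) pos_mod_bound[of m "q - i"] by linarith
    have "q' - i = m * ((q - i) div m) + ((q - i) mod m + 1)"
      using that by (simp add: algebra_simps)
    then show ?thesis
      using lt assms(1) pos_mod_sign[of m "q - i"]
      by (metis add.commute add_nonneg_pos div_mult_self2 div_pos_pos_trivial add_0
          less_imp_le not_less zero_less_one)
  qed
  from assms(2) consider "q' = q" | "q' = q + 1" | "q = q' + 1" by linarith
  then show ?thesis using *[of q' q] *[of q q'] assms(3,4) by cases auto
qed

text \<open>The line is cut into tiles of length \<open>r\<close>, and \<open>m = n + 2\<close> colours are available. Over the tile
  number \<open>q\<close> the space is covered by \<open>n + 1\<close> sets, one for each colour except \<open>q mod m\<close>. Then a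
  colour \<open>i\<close> is missing over every \<open>m\<close>-th tile, and an \<open>r\<close>-chain of colour \<open>i\<close> is confined to the
  \<open>m - 1\<close> tiles of one block. Let the scale of the cover over tile \<open>q\<close> depend only on \<open>q mod m\<close>
  and grow fast with this residue. In one block each residue other than \<open>i\<close> occurs once, so the
  sets of colour \<open>i\<close> over the block can be united by \<open>components_bounded_UN\<close>.\<close>

lemma uniform_asdim_le_fibration:
  assumes sub: "\<And>E. E \<in> \<E> \<Longrightarrow> E \<subseteq> mspace M"
    and lip: "\<And>x y. x \<in> mspace M \<Longrightarrow> y \<in> mspace M \<Longrightarrow> \<bar>h x - h y\<bar> \<le> mdist M x y"
    and fib: "\<And>L. uniform_asdim_le M {{x \<in> E. h x \<in> {c..c + L}} | E c. E \<in> \<E>} n"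
  shows "uniform_asdim_le M \<E> (Suc n)"
  unfolding uniform_asdim_le_def
proof (intro allI impI)
  fix r :: real assume r: "r > 0"
  define m where "m = n + 2"
  obtain Rf where Rf0: "\<And>s. 0 \<le> Rf s" and Rf:
    "\<And>s F. 0 < s \<Longrightarrow> F \<in> {{x \<in> E. h x \<in> {c..c + r}} | E c. E \<in> \<E>} \<Longrightarrow>
       \<exists>C. F = (\<Union>i\<le>n. C i) \<and> (\<forall>i\<le>n. components_bounded M s (Rf s) (C i))"
    using uniform_asdim_le_imp_control[OF fib[of r]] by blast
  define scale where "scale l = accumulated_bound Rf r l + 2 * r" for l
  have scale: "scale l > 0" for l
    using accumulated_bound_nonneg[of Rf r l] Rf0 r by (auto simp: scale_def)
  show "\<exists>R. \<forall>E\<in>\<E>. \<exists>C. E = (\<Union>i\<le>Suc n. C i) \<and> (\<forall>i\<le>Suc n. components_bounded M r R (C i))"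
  proof (rule exI[of _ "accumulated_bound Rf r m"], rule ballI)
    fix E assume E: "E \<in> \<E>"
    define tile where "tile x = \<lfloor>h x / r\<rfloor>" for x
    define level where "level q = nat (q mod int m)" for q :: int
    have level: "level q < m" "int (level q) = q mod int m" for q
      by (auto simp: level_def m_def nat_less_iff)
    have "\<exists>C. {x \<in> E. h x \<in> {of_int q * r..of_int q * r + r}} = (\<Union>i\<le>n. C i) \<and>
        (\<forall>i\<le>n. components_bounded M (scale (level q)) (Rf (scale (level q))) (C i))" for q :: int
      by (rule Rf) (use scale E in auto)
    then obtain C0 where C0: "\<And>q::int. {x \<in> E. h x \<in> {of_int q * r..of_int q * r + r}} = (\<Union>i\<le>n. C0 q i)"
      "\<And>(q::int) i. i \<le> n \<Longrightarrow> components_bounded M (scale (level q)) (Rf (scale (level q))) (C0 q i)"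
      by metis
    \<comment> \<open>Rename the colours so that \<open>level q\<close> becomes the missing one.\<close>
    define C1 where "C1 q i = (if i = level q then {} else C0 q (if i < level q then i else i - 1))"
      for q i
    have C1_bounded: "components_bounded M (scale (level q)) (Rf (scale (level q))) (C1 q i)"
      if "i < m" for q i
    proof (cases "i = level q")
      case True
      then show ?thesis by (simp add: C1_def components_bounded_def)
    next
      case False
      then have "(if i < level q then i else i - 1) \<le> n"
        using level(1)[of q] that by (auto simp: m_def)
      then show ?thesis using False C0(2) by (simp add: C1_def)
    qed
    have C1_sub: "C1 q i \<subseteq> E" if "i < m" for q i
    proof (cases "i = level q")
      case False
      then have "(if i < level q then i else i - 1) \<le> n"
        using level(1)[of q] that by (auto simp: m_def)
      then have "C1 q i \<subseteq> (\<Union>i\<le>n. C0 q i)" using False by (auto simp: C1_def)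
      then show ?thesis unfolding C0(1)[symmetric] by auto
    qed (simp add: C1_def)
    define F where "F i = {x. x \<in> C1 (tile x) i}" for i
    have tile_bounds: "h x \<in> {of_int (tile x) * r..of_int (tile x) * r + r}" for x
    proof -
      have "of_int (tile x) \<le> h x / r" "h x / r \<le> of_int (tile x) + 1"
        unfolding tile_def by linarith+
      then have "of_int (tile x) * r \<le> h x" "h x \<le> (of_int (tile x) + 1) * r"
        using r by (simp_all add: pos_le_divide_eq pos_divide_le_eq)
      then show ?thesis by (simp add: algebra_simps)
    qed
    have cover: "x \<in> (\<Union>i\<le>Suc n. F i)" if x: "x \<in> E" for x
    proof -
      have "x \<in> (\<Union>i\<le>n. C0 (tile x) i)"
        unfolding C0(1)[symmetric] using x tile_bounds by auto
      then obtain i where i: "i \<le> n" "x \<in> C0 (tile x) i" by auto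
      define i' where "i' = (if i < level (tile x) then i else Suc i)"
      have "x \<in> C1 (tile x) i'" using i by (auto simp: C1_def i'_def)
      moreover have "i' \<le> Suc n" using i by (auto simp: i'_def)
      ultimately show ?thesis by (auto simp: F_def)
    qed
    have F_sub: "F i \<subseteq> E" if "i \<le> Suc n" for i
      using C1_sub[of i] that by (auto simp: F_def m_def)
    have F_bounded: "components_bounded M r (accumulated_bound Rf r m) (F i)"
      if i: "i \<le> Suc n" for i
      unfolding components_bounded_def
    proof (intro ballI allI impI)
      fix x y assume x: "x \<in> F i" and xy: "(x, y) \<in> (steps M r (F i))\<^sup>*"
      define block where "block x = (tile x - int i) div int m" for x
      \<comment> \<open>The tile of residue \<open>l\<close> in the block of \<open>x\<close>.\<close>
      define tl where "tl l = block x * int m + int i + ((int l - int i) mod int m)" for l :: nat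
      define A where "A l = C1 (tl l) i" for l
      have im: "i < m" using i by (auto simp: m_def)
      have tile_tl: "tl (level (tile z)) = tile z" if "block z = block x" for z
      proof -
        have "(int (level (tile z)) - int i) mod int m = (tile z - int i) mod int m"
          by (simp add: level(2) mod_diff_left_eq)
        then show ?thesis
          using that div_mult_mod_eq[of "tile z - int i" "int m"] by (simp add: tl_def block_def)
      qed
      have level_tl: "level (tl l) = l" if "l < m" for l
      proof -
        have "tl l mod int m = (int i + (int l - int i) mod int m) mod int m"
          by (simp add: tl_def add.assoc)
        also have "\<dots> = int l" using that by (simp add: mod_add_right_eq)
        finally show ?thesis by (simp add: level_def)
      qed
      have in_A: "z \<in> (\<Union>l<m. A l)" if "z \<in> F i" "block z = block x" for z
        using that tile_tl[OF that(2)] level(1)[of "tile z"] by (force simp: F_def A_def)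
      have "y \<in> F i \<and> block y = block x \<and> (x, y) \<in> (steps M r (\<Union>l<m. A l))\<^sup>*"
        using xy
      proof (induction rule: rtrancl_induct)
        case base
        then show ?case using x by auto
      next
        case (step y z)
        have z: "y \<in> F i" "z \<in> F i" "mdist M y z \<le> r" using step(2) by (auto simp: steps_def)
        have "y \<in> mspace M" "z \<in> mspace M" using z F_sub[OF i] sub[OF E] by auto
        then have "\<bar>h y - h z\<bar> \<le> r" using lip z(3) by force
        then have adj: "\<bar>tile y - tile z\<bar> \<le> 1" unfolding tile_def using r by (rule floor_div_step[rotated])
        have ne: "tile w mod int m \<noteq> int i mod int m" if "w \<in> F i" for w
        proof
          assume "tile w mod int m = int i mod int m"
          then have "i = level (tile w)" using im by (simp add: level_def)
          then show False using that by (simp add: F_def C1_def)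
        qed
        have "block y = block z" unfolding block_def
          using adj ne[OF z(1)] ne[OF z(2)] by (intro same_block) (auto simp: m_def)
        then have bl: "block z = block x" using step by simp
        have "(y, z) \<in> steps M r (\<Union>l<m. A l)"
          unfolding steps_def using in_A[OF z(1)] in_A[OF z(2) bl] step z(3) by blast
        then show ?case using step z bl by auto
      qed
      moreover have "components_bounded M r (accumulated_bound Rf r m) (\<Union>l<m. A l)"
      proof (rule components_bounded_UN)
        fix l assume l: "l < m"
        show "A l \<subseteq> mspace M" using C1_sub[OF im] sub[OF E] by (auto simp: A_def)
        show "components_bounded M (accumulated_bound Rf r l + 2 * r)
              (Rf (accumulated_bound Rf r l + 2 * r)) (A l)"
          using C1_bounded[OF im, of "tl l"] by (simp add: A_def level_tl[OF l] scale_def)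
      qed (use Rf0 r in auto)
      ultimately show "mdist M x y \<le> accumulated_bound Rf r m"
        using in_A[OF x] by (auto intro: components_boundedD)
    qed
    have "E = (\<Union>i\<le>Suc n. F i)" using cover F_sub by blast
    then show "\<exists>C. E = (\<Union>i\<le>Suc n. C i) \<and>
        (\<forall>i\<le>Suc n. components_bounded M r (accumulated_bound Rf r m) (C i))"
      using F_bounded by blast
  qed
qed

section \<open>Open coverings from coarse components\<close>

lemma multiplicity_cov_le:
  assumes colours: "\<U> = (\<Union>i\<le>n. \<C> i)" and disj: "\<And>i. i \<le> n \<Longrightarrow> pairwise disjnt (\<C> i)"
  shows "multiplicity_cov \<U> \<le> enat (n + 1)"
  unfolding multiplicity_cov_def
proof (rule SUP_least, clarify)
  fix \<F> x assume F: "\<F> \<subseteq> \<U>" "finite \<F>" "\<Inter>\<F> \<noteq> {}"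
  then obtain x where x: "x \<in> \<Inter>\<F>" by blast
  have "\<forall>U\<in>\<F>. \<exists>i\<le>n. U \<in> \<C> i" using F colours by auto
  then obtain c where c: "\<And>U. U \<in> \<F> \<Longrightarrow> c U \<le> n \<and> U \<in> \<C> (c U)" by metis
  have "inj_on c \<F>"
  proof (rule inj_onI)
    fix U V assume UV: "U \<in> \<F>" "V \<in> \<F>" "c U = c V"
    then have "U \<in> \<C> (c U)" "V \<in> \<C> (c U)" "c U \<le> n" "\<not> disjnt U V"
      using c[of U] c[of V] x by (auto simp: disjnt_iff)
    then show "U = V" using disj by (auto simp: pairwise_def)
  qed
  then have "card \<F> \<le> card {..n}"
    using c by (intro card_inj_on_le) auto
  then show "enat (card \<F>) \<le> enat (n + 1)" by simp
qed

definition nbhd :: "'a metric \<Rightarrow> real \<Rightarrow> 'a set \<Rightarrow> 'a set" where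
  "nbhd M d K = {x \<in> mspace M. \<exists>y\<in>K. mdist M y x < d}"

lemma openin_nbhd:
  assumes "K \<subseteq> mspace M"
  shows "openin (mtopology_of M) (nbhd M d K)"
proof -
  interpret Metric_space "mspace M" "mdist M" by simp
  have "nbhd M d K = (\<Union>y\<in>K. mball y d)"
    using assms by (auto simp: nbhd_def mball_def)
  then show ?thesis by (auto simp: mtopology_of_def)
qed

text \<open>The \<open>d\<close>-neighbourhoods of the \<open>2 * d\<close>-components of one colour are disjoint, so at most one of
  each colour contains a given point; and every \<open>d\<close>-ball lies in one of them, namely in the
  neighbourhood of the component of its centre.\<close>

lemma asdim_le_of_uniform_asdim_le:
  assumes "uniform_asdim_le M {mspace M} n"
  shows "asdim M \<le> enat n"
proof -
  have "\<exists>\<U>. open_covering M \<U> \<and> multiplicity_cov \<U> \<le> enat (n + 1) \<and> mesh M \<U> < \<infinity> \<and>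
      lebesgue_num M \<U> \<ge> ennreal d" if d: "d > 0" for d :: real
  proof -
    obtain R C where C: "mspace M = (\<Union>i\<le>n. C i)"
      "\<And>i. i \<le> n \<Longrightarrow> components_bounded M (2 * d) R (C i)"
      using assms d unfolding uniform_asdim_le_def by (metis insertI1 mult_pos_pos zero_less_numeral)
    define comp where "comp i x = {y. (x, y) \<in> (steps M (2 * d) (C i))\<^sup>*}" for i x
    define \<C> where "\<C> i = (\<lambda>x. nbhd M d (comp i x)) ` C i" for i
    define \<U> where "\<U> = (\<Union>i\<le>n. \<C> i)"
    have comp_sub: "comp i x \<subseteq> C i" "comp i x \<subseteq> mspace M" if "i \<le> n" "x \<in> C i" for i x
      using that C(1) chain_end_in[of x _ M "2 * d" "C i"] by (auto simp: comp_def)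
    have comp_self: "x \<in> nbhd M d (comp i x)" if "i \<le> n" "x \<in> C i" for i x
    proof -
      have "x \<in> mspace M" using that C(1) by auto
      moreover from this have "mdist M x x = 0" by simp
      then have "mdist M x x < d" using d by simp
      moreover have "x \<in> comp i x" by (simp add: comp_def)
      ultimately show ?thesis by (auto simp: nbhd_def)
    qed
    have "open_covering M \<U>"
      unfolding open_covering_def
    proof
      show "\<forall>U\<in>\<U>. openin (mtopology_of M) U"
        using comp_sub(2) by (auto simp: \<U>_def \<C>_def intro!: openin_nbhd)
      show "\<Union>\<U> = mspace M"
      proof
        show "\<Union>\<U> \<subseteq> mspace M" by (auto simp: \<U>_def \<C>_def nbhd_def)
        show "mspace M \<subseteq> \<Union>\<U>"
        proof
          fix x assume "x \<in> mspace M"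
          then obtain i where "i \<le> n" "x \<in> C i" using C(1) by auto
          then show "x \<in> \<Union>\<U>" using comp_self[of i x] by (auto simp: \<U>_def \<C>_def)
        qed
      qed
    qed
    moreover have "multiplicity_cov \<U> \<le> enat (n + 1)"
    proof (rule multiplicity_cov_le[OF \<U>_def])
      fix i assume i: "i \<le> n"
      show "pairwise disjnt (\<C> i)"
      proof (rule pairwiseI, rule ccontr)
        fix U V assume "U \<in> \<C> i" "V \<in> \<C> i" and ne: "U \<noteq> V" and "\<not> disjnt U V"
        then obtain x y z where xy: "x \<in> C i" "y \<in> C i" "U = nbhd M d (comp i x)"
          "V = nbhd M d (comp i y)" "z \<in> U" "z \<in> V"
          by (auto simp: \<C>_def disjnt_iff)
        then obtain x' y' where x': "x' \<in> comp i x" "y' \<in> comp i y" "mdist M x' z < d"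
          "mdist M y' z < d" "z \<in> mspace M" by (auto simp: nbhd_def)
        have mem: "x' \<in> C i" "y' \<in> C i" "x' \<in> mspace M" "y' \<in> mspace M"
          using x' comp_sub[OF i xy(1)] comp_sub[OF i xy(2)] by auto
        have "mdist M x' y' \<le> mdist M x' z + mdist M z y'"
          using mem x' by (intro mdist_triangle) auto
        then have "(x', y') \<in> steps M (2 * d) (C i)"
          using x' mem by (simp add: steps_def mdist_commute[of M z])
        then have "(x, y) \<in> (steps M (2 * d) (C i))\<^sup>*"
          using x'(1) chain_sym[of y y' M "2 * d" "C i"] x'(2) unfolding comp_def
          by (metis mem_Collect_eq rtrancl.rtrancl_into_rtrancl rtrancl_trans)
        then have "comp i x = comp i y"
          unfolding comp_def using chain_sym[of x y] by (auto intro: rtrancl_trans)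
        then show False using ne xy by simp
      qed
    qed
    moreover have "mesh M \<U> \<le> ennreal (d + R + R + d)"
      unfolding mesh_def
    proof (intro SUP_least)
      fix U v w assume U: "U \<in> \<U>" and vw: "v \<in> U" "w \<in> U"
      then obtain i x where x: "i \<le> n" "x \<in> C i" "U = nbhd M d (comp i x)"
        by (auto simp: \<U>_def \<C>_def)
      obtain v' w' where v': "v' \<in> comp i x" "w' \<in> comp i x" "mdist M v' v < d" "mdist M w' w < d"
        "v \<in> mspace M" "w \<in> mspace M"
        using vw unfolding x(3) nbhd_def by auto
      have mem: "v' \<in> mspace M" "w' \<in> mspace M" "x \<in> mspace M"
        using comp_sub[OF x(1,2)] v' x C(1) by auto
      have "mdist M x v' \<le> R" "mdist M x w' \<le> R"
        using v' components_boundedD[OF C(2)[OF x(1)] x(2)] by (auto simp: comp_def)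
      moreover have "mdist M v w \<le> mdist M v v' + mdist M v' w"
        "mdist M v' w \<le> mdist M v' x + mdist M x w" "mdist M x w \<le> mdist M x w' + mdist M w' w"
        using mem v' by (auto intro: mdist_triangle)
      ultimately show "ennreal (mdist M v w) \<le> ennreal (d + R + R + d)"
        using v' by (intro ennreal_leI) (simp add: mdist_commute[of M v v'] mdist_commute[of M v' x])
    qed
    then have "mesh M \<U> < \<infinity>"
      by (metis ennreal_less_top infinity_ennreal_def le_less_trans)
    moreover have "lebesgue_num M \<U> \<ge> ennreal d"
      unfolding lebesgue_num_def
    proof (rule INF_greatest)
      fix z assume z: "z \<in> mspace M"
      then obtain i where i: "i \<le> n" "z \<in> C i" using C(1) by auto
      define U where "U = nbhd M d (comp i z)"
      have "ennreal d \<le> (INF w\<in>mspace M - U. ennreal (mdist M z w))"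
      proof (rule INF_greatest)
        fix w assume "w \<in> mspace M - U"
        then have "\<not> mdist M z w < d" by (auto simp: U_def nbhd_def comp_def)
        then show "ennreal d \<le> ennreal (mdist M z w)" by (intro ennreal_leI) simp
      qed
      also have "\<dots> \<le> (SUP U\<in>\<U>. INF w\<in>mspace M - U. ennreal (mdist M z w))"
        using i by (intro SUP_upper) (auto simp: \<U>_def \<C>_def U_def)
      finally show "ennreal d \<le> (SUP U\<in>\<U>. INF w\<in>mspace M - U. ennreal (mdist M z w))" .
    qed
    ultimately show ?thesis by blast
  qed
  then show ?thesis unfolding asdim_def by (intro Inf_lower) blast
qed

section \<open>Shadows on the boundary at infinity\<close>

lemma gromov_product_nonneg:
  assumes "p \<in> mspace X" "x \<in> mspace X" "y \<in> mspace X"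
  shows "0 \<le> gromov_product X p x y"
  using mdist_triangle[of x X p y] assms by (simp add: gromov_product_def mdist_commute[of X p y])

lemma gromov_product_change_base:
  assumes "p \<in> mspace X" "q \<in> mspace X" "x \<in> mspace X" "y \<in> mspace X"
  shows "gromov_product X q x y \<le> gromov_product X p x y + mdist X p q"
  using mdist_triangle[of x X p q] mdist_triangle[of y X p q] assms
  by (simp add: gromov_product_def field_simps)

lemma gromov_product_commute: "gromov_product X p x y = gromov_product X p y x"
  by (simp add: gromov_product_def mdist_commute)

lemma delta_hyperbolic_three_steps:
  assumes "delta_hyperbolic \<delta> X" "0 \<le> \<delta>" "p \<in> mspace X"
    and "w \<in> mspace X" "x \<in> mspace X" "y \<in> mspace X" "z \<in> mspace X"
    and "t \<le> gromov_product X p w x" "t \<le> gromov_product X p x y" "t \<le> gromov_product X p y z"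
  shows "t - 2 * \<delta> \<le> gromov_product X p w z"
proof -
  have "gromov_product X p w y \<ge> min (gromov_product X p w x) (gromov_product X p x y) - \<delta>"
    "gromov_product X p w z \<ge> min (gromov_product X p w y) (gromov_product X p y z) - \<delta>"
    using assms unfolding delta_hyperbolic_def by blast+
  then show ?thesis using assms by linarith
qed

lemma gromov_boundary_nonempty:
  assumes "gromov_hyperbolic X" "\<xi> \<in> gromov_boundary X"
  shows "\<xi> \<noteq> {}"
  using assms equiv_infinity_rel in_quotient_imp_non_empty unfolding gromov_boundary_def by blast

lemma gromov_boundary_range:
  assumes "\<xi> \<in> gromov_boundary X" "u \<in> \<xi>"
  shows "u i \<in> mspace X"
  using assms
  by (auto simp: gromov_boundary_def quotient_def infinity_rel_def converges_to_infinity_def)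

lemma gromov_product_bdry_geI:
  assumes "\<And>u v. u \<in> \<xi> \<Longrightarrow> v \<in> \<eta> \<Longrightarrow> \<forall>\<^sub>F i in sequentially. t \<le> gromov_product X p (u i) (v i)"
  shows "ereal t \<le> gromov_product_bdry X p \<xi> \<eta>"
  unfolding gromov_product_bdry_def
  by (rule INF_greatest) (use assms in \<open>auto intro!: Liminf_bounded\<close>)

lemma less_gromov_product_bdryD:
  assumes "ereal t < gromov_product_bdry X p \<xi> \<eta>" "u \<in> \<xi>" "v \<in> \<eta>"
  shows "\<forall>\<^sub>F i in sequentially. t < gromov_product X p (u i) (v i)"
proof -
  have "gromov_product_bdry X p \<xi> \<eta> \<le> liminf (\<lambda>i. ereal (gromov_product X p (u i) (v i)))"
    unfolding gromov_product_bdry_def using assms by (intro INF_lower2[of "(u, v)"]) auto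
  then have "ereal t < liminf (\<lambda>i. ereal (gromov_product X p (u i) (v i)))"
    using assms by simp
  from less_LiminfD[OF this] show ?thesis by simp
qed

lemma gromov_product_bdry_nonneg:
  assumes "p \<in> mspace X" "\<xi> \<in> gromov_boundary X" "\<eta> \<in> gromov_boundary X"
  shows "0 \<le> gromov_product_bdry X p \<xi> \<eta>"
  unfolding zero_ereal_def
proof (rule gromov_product_bdry_geI)
  fix u v assume "u \<in> \<xi>" "v \<in> \<eta>"
  then have "u i \<in> mspace X" "v i \<in> mspace X" for i
    using assms(2,3) by (auto intro: gromov_boundary_range)
  then show "\<forall>\<^sub>F i in sequentially. 0 \<le> gromov_product X p (u i) (v i)"
    using gromov_product_nonneg[OF assms(1)] by simp
qed

lemma neg_powr_le:
  assumes "1 < a" "ereal t \<le> s"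
  shows "neg_powr a s \<le> a powr (- t)"
  using assms by (cases s) (auto simp: neg_powr_def)

text \<open>Nonnegativity of \<open>s\<close> excludes \<open>s = -\<infinity>\<close>, where \<open>real_of_ereal\<close> is 0 and \<open>neg_powr a s\<close> is 1.\<close>

lemma less_of_neg_powr_less:
  assumes "1 < a" "0 \<le> s" "neg_powr a s < a powr (- t)"
  shows "ereal t < s"
  using assms by (cases s) (auto simp: neg_powr_def)

text \<open>The base points of a visual space and of a visual metric may differ. A change of base point moves
  distances and Gromov products by a bounded amount, which \<open>D\<close> absorbs. The boundary
  point is represented by its sequences, to which the inequality of hyperbolicity applies.\<close>

lemma visual_at_any_base:
  assumes "visual_hyperbolic X" and p: "p \<in> mspace X"
  obtains D \<Xi> where "\<And>x. x \<in> mspace X \<Longrightarrow> \<Xi> x \<in> gromov_boundary X"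
    and "\<And>x u. x \<in> mspace X \<Longrightarrow> u \<in> \<Xi> x \<Longrightarrow>
      \<forall>\<^sub>F i in sequentially. mdist X x p - D \<le> gromov_product X p x (u i)"
proof -
  obtain q D where q: "q \<in> mspace X" and D: "\<And>x. x \<in> mspace X \<Longrightarrow>
      \<exists>\<xi>\<in>gromov_boundary X. ereal (mdist X x q) \<le> gromov_product_mixed X q x \<xi> + ereal D"
    using assms(1) unfolding visual_hyperbolic_def by blast
  from D obtain \<Xi> where \<Xi>: "\<And>x. x \<in> mspace X \<Longrightarrow> \<Xi> x \<in> gromov_boundary X"
      "\<And>x. x \<in> mspace X \<Longrightarrow> ereal (mdist X x q) \<le> gromov_product_mixed X q x (\<Xi> x) + ereal D"
    by metis
  have "\<forall>\<^sub>F i in sequentially. mdist X x p - (D + 1 + 2 * mdist X p q) \<le> gromov_product X p x (u i)"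
    if x: "x \<in> mspace X" and u: "u \<in> \<Xi> x" for x u
  proof -
    have "gromov_product_mixed X q x (\<Xi> x) \<le> liminf (\<lambda>i. ereal (gromov_product X q x (u i)))"
      unfolding gromov_product_mixed_def using u by (intro INF_lower)
    moreover have "ereal (mdist X x q - D - 1) < gromov_product_mixed X q x (\<Xi> x)"
      using \<Xi>(2)[OF x] by (cases "gromov_product_mixed X q x (\<Xi> x)") auto
    ultimately have "ereal (mdist X x q - D - 1) < liminf (\<lambda>i. ereal (gromov_product X q x (u i)))"
      by simp
    from less_LiminfD[OF this] show ?thesis
    proof eventually_elim
      case (elim i)
      have "u i \<in> mspace X" using \<Xi>(1)[OF x] u by (rule gromov_boundary_range)
      then have "gromov_product X q x (u i) \<le> gromov_product X p x (u i) + mdist X p q"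
        using p q x by (intro gromov_product_change_base)
      moreover have "mdist X x p \<le> mdist X x q + mdist X p q"
        using mdist_triangle[OF x q p] by (simp add: mdist_commute)
      ultimately show ?case using elim by simp
    qed
  qed
  with \<Xi>(1) show ?thesis using that by blast
qed

text \<open>The two implications are what is needed to pull coverings back along \<open>\<phi>\<close>: \<open>r\<close>-chains go to
  \<open>\<rho>\<close>-chains, and preimages of sets of diameter \<open>\<tau>\<close> have diameter at most \<open>R\<close>.\<close>

definition coarse_map ::
    "'a metric \<Rightarrow> 'b metric \<Rightarrow> real \<Rightarrow> real \<Rightarrow> real \<Rightarrow> real \<Rightarrow> 'a set \<Rightarrow> ('a \<Rightarrow> 'b) \<Rightarrow> bool" where
  "coarse_map M W r \<rho> \<tau> R A \<phi> \<longleftrightarrow> (\<forall>x\<in>A. \<phi> x \<in> mspace W \<and>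
     (\<forall>y\<in>A. (mdist M x y \<le> r \<longrightarrow> mdist W (\<phi> x) (\<phi> y) \<le> \<rho>) \<and>
            (mdist W (\<phi> x) (\<phi> y) \<le> \<tau> \<longrightarrow> mdist M x y \<le> R)))"

text \<open>Let \<open>\<Xi> x\<close> be a boundary point behind \<open>x\<close>. If \<open>x\<close> and \<open>y\<close> have height about \<open>c\<close>, then the Gromov
  products of \<open>x\<close> with \<open>\<Xi> x\<close> and of \<open>y\<close> with \<open>\<Xi> y\<close> are about \<open>c\<close>. Hyperbolicity then says that
  the product of \<open>x\<close> and \<open>y\<close> is at least about \<open>c\<close> (that is, the points are close) if and only if
  the product of \<open>\<Xi> x\<close> and \<open>\<Xi> y\<close> is (that is, the distance of the shadows is at most a constant
  times \<open>a powr (- c)\<close>). The order of the quantifiers matters: \<open>R\<close> does not depend on \<open>c\<close>. The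
  target scale \<open>\<rho>\<close> may be prescribed because the factor \<open>s\<close> can be chosen small relative to
  \<open>a powr c\<close>.\<close>

lemma shadow_maps_at_height:
  assumes vis: "visual_hyperbolic X" and "visual_metric X B"
  obtains p where "p \<in> mspace X" and
    "\<And>L r \<rho> \<tau>. 0 < \<rho> \<Longrightarrow> 0 < \<tau> \<Longrightarrow> \<exists>R. \<forall>c. \<exists>s\<ge>1. \<exists>\<phi>.
       coarse_map X (scale_metric s B) r \<rho> \<tau> R {x \<in> mspace X. mdist X x p \<in> {c..c + L}} \<phi>"
proof -
  obtain p a c1 c2 where p: "p \<in> mspace X" and a: "1 < a" and c: "0 < c1" "0 < c2"
    and B: "mspace B = gromov_boundary X"
    and lower: "\<And>\<xi> \<eta>. \<xi> \<in> gromov_boundary X \<Longrightarrow> \<eta> \<in> gromov_boundary X \<Longrightarrow>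
      c1 * neg_powr a (gromov_product_bdry X p \<xi> \<eta>) \<le> mdist B \<xi> \<eta>"
    and upper: "\<And>\<xi> \<eta>. \<xi> \<in> gromov_boundary X \<Longrightarrow> \<eta> \<in> gromov_boundary X \<Longrightarrow>
      mdist B \<xi> \<eta> \<le> c2 * neg_powr a (gromov_product_bdry X p \<xi> \<eta>)"
    using assms(2) unfolding visual_metric_def by blast
  have hyp: "gromov_hyperbolic X" using vis by (simp add: visual_hyperbolic_def)
  then obtain \<delta> where \<delta>: "0 \<le> \<delta>" "delta_hyperbolic \<delta> X" by (auto simp: gromov_hyperbolic_def)
  obtain D \<Xi> where \<Xi>: "\<And>x. x \<in> mspace X \<Longrightarrow> \<Xi> x \<in> gromov_boundary X"
    and D: "\<And>x u. x \<in> mspace X \<Longrightarrow> u \<in> \<Xi> x \<Longrightarrow>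
      \<forall>\<^sub>F i in sequentially. mdist X x p - D \<le> gromov_product X p x (u i)"
    using visual_at_any_base[OF vis p] by metis
  show ?thesis
  proof (rule that[OF p])
    fix L r \<rho> \<tau> :: real assume \<rho>: "0 < \<rho>" and \<tau>: "0 < \<tau>"
    define K1 where "K1 = \<bar>D\<bar> + \<bar>r\<bar> + 2 * \<delta>"
    have K1: "ereal (c - K1) \<le> gromov_product_bdry X p (\<Xi> x) (\<Xi> y)"
      if x: "x \<in> mspace X" and y: "y \<in> mspace X" and h: "c \<le> mdist X x p" "c \<le> mdist X y p"
        and r: "mdist X x y \<le> r" for x y c
    proof (rule gromov_product_bdry_geI)
      fix u v assume u: "u \<in> \<Xi> x" and v: "v \<in> \<Xi> y"
      show "\<forall>\<^sub>F i in sequentially. c - K1 \<le> gromov_product X p (u i) (v i)"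
        using D[OF x u] D[OF y v]
      proof eventually_elim
        case (elim i)
        have "c - \<bar>D\<bar> - \<bar>r\<bar> \<le> gromov_product X p x y"
          using h r by (simp add: gromov_product_def)
        moreover have "u i \<in> mspace X" "v i \<in> mspace X"
          using \<Xi>[OF x] \<Xi>[OF y] u v by (auto intro: gromov_boundary_range)
        ultimately have "c - \<bar>D\<bar> - \<bar>r\<bar> - 2 * \<delta> \<le> gromov_product X p (u i) (v i)"
          using elim h x y p \<delta> gromov_product_commute[of X p x "u i"]
          by (intro delta_hyperbolic_three_steps[of \<delta> X p "u i" x y "v i"]) auto
        then show ?case by (simp add: K1_def)
      qed
    qed
    \<comment> \<open>The factor that makes the bound from \<open>K1\<close> equal to \<open>\<rho>\<close>, whatever the height \<open>c\<close>.\<close>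
    define \<mu> where "\<mu> = \<rho> / (c2 * a powr K1)"
    have \<mu>: "0 < \<mu>" using \<rho> c a by (simp add: \<mu>_def)
    \<comment> \<open>The summand 1 makes the bound strict, as \<open>less_of_neg_powr_less\<close> requires.\<close>
    define K2 where "K2 = log a (\<tau> / (\<mu> * c1)) + 1"
    have pos: "0 < \<tau> / (\<mu> * c1)" using \<tau> \<mu> c by simp
    then have "a powr K2 = \<tau> / (\<mu> * c1) * a"
      using a by (simp add: K2_def powr_add)
    then have K2: "\<tau> / (\<mu> * c1) < a powr K2"
      using mult_strict_left_mono[OF a pos] by simp
    define K3 where "K3 = max K2 D + 2 * \<delta>"
    have K3: "c - K3 \<le> gromov_product X p x y"
      if x: "x \<in> mspace X" and y: "y \<in> mspace X" and h: "c \<le> mdist X x p" "c \<le> mdist X y p"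
        and K: "ereal (c - K2) < gromov_product_bdry X p (\<Xi> x) (\<Xi> y)" for x y c
    proof -
      obtain u v where uv: "u \<in> \<Xi> x" "v \<in> \<Xi> y"
        using gromov_boundary_nonempty[OF hyp \<Xi>[OF x]] gromov_boundary_nonempty[OF hyp \<Xi>[OF y]]
        by auto
      have "\<forall>\<^sub>F i in sequentially. c - K3 \<le> gromov_product X p x y"
        using D[OF x uv(1)] D[OF y uv(2)] less_gromov_product_bdryD[OF K uv]
      proof eventually_elim
        case (elim i)
        have "u i \<in> mspace X" "v i \<in> mspace X"
          using \<Xi>[OF x] \<Xi>[OF y] uv by (auto intro: gromov_boundary_range)
        then have "c - max K2 D - 2 * \<delta> \<le> gromov_product X p x y"
          using elim h x y p \<delta> gromov_product_commute[of X p y "v i"]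
          by (intro delta_hyperbolic_three_steps[of \<delta> X p x "u i" "v i" y]) auto
        then show ?case by (simp add: K3_def)
      qed
      then show ?thesis by simp
    qed
    define R where "R = max (2 * (L + K3)) (2 * (L - log a \<mu>))"
    have "\<exists>s\<ge>1. \<exists>\<phi>. coarse_map X (scale_metric s B) r \<rho> \<tau> R
            {x \<in> mspace X. mdist X x p \<in> {c..c + L}} \<phi>" for c
    proof (cases "1 \<le> \<mu> * a powr c")
      case True
      then have s: "0 < \<mu> * a powr c" by simp
      have near: "\<mu> * a powr c * mdist B (\<Xi> x) (\<Xi> y) \<le> \<rho>"
        if x: "x \<in> mspace X" and y: "y \<in> mspace X" and h: "c \<le> mdist X x p" "c \<le> mdist X y p"
          and r: "mdist X x y \<le> r" for x y
      proof -
        have "mdist B (\<Xi> x) (\<Xi> y) \<le> c2 * neg_powr a (gromov_product_bdry X p (\<Xi> x) (\<Xi> y))"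
          using \<Xi> x y by (intro upper) auto
        also have "\<dots> \<le> c2 * a powr (- (c - K1))"
          using c neg_powr_le[OF a K1[OF x y h r]] by (intro mult_left_mono) auto
        also have "a powr (- (c - K1)) = a powr K1 / a powr c"
          by (simp add: powr_diff[symmetric])
        finally have "\<mu> * a powr c * mdist B (\<Xi> x) (\<Xi> y) \<le>
            \<mu> * a powr c * (c2 * (a powr K1 / a powr c))"
          using s by (intro mult_left_mono) auto
        also have "\<dots> = \<rho>" using a c by (simp add: \<mu>_def)
        finally show ?thesis .
      qed
      have far: "mdist X x y \<le> R"
        if x: "x \<in> mspace X" and y: "y \<in> mspace X"
          and h: "mdist X x p \<in> {c..c + L}" "mdist X y p \<in> {c..c + L}"
          and le: "\<mu> * a powr c * mdist B (\<Xi> x) (\<Xi> y) \<le> \<tau>" for x y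
      proof -
        let ?g = "gromov_product_bdry X p (\<Xi> x) (\<Xi> y)"
        have "c1 * neg_powr a ?g \<le> mdist B (\<Xi> x) (\<Xi> y)"
          using \<Xi> x y by (intro lower) auto
        also have "\<dots> \<le> \<tau> / (\<mu> * a powr c)"
          using le s by (simp add: pos_le_divide_eq mult.commute)
        finally have bound: "c1 * neg_powr a ?g \<le> \<tau> / (\<mu> * a powr c)" .
        have "neg_powr a ?g = c1 * neg_powr a ?g / c1" using c by simp
        also have "\<dots> \<le> \<tau> / (\<mu> * a powr c) / c1"
          using bound c by (intro divide_right_mono) auto
        also have "\<dots> = \<tau> / (\<mu> * c1) * a powr (- c)"
          by (simp add: powr_minus field_simps)
        also have "\<dots> < a powr K2 * a powr (- c)"
          using K2 a by (intro mult_strict_right_mono) auto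
        also have "\<dots> = a powr (- (c - K2))"
          by (simp add: powr_add[symmetric])
        finally have "ereal (c - K2) < ?g"
          using a p \<Xi> x y by (intro less_of_neg_powr_less gromov_product_bdry_nonneg) auto
        then have "c - K3 \<le> gromov_product X p x y"
          using x y h by (intro K3) auto
        then have "mdist X x y \<le> 2 * (L + K3)"
          using h by (simp add: gromov_product_def)
        then show ?thesis by (simp add: R_def)
      qed
      have "coarse_map X (scale_metric (\<mu> * a powr c) B) r \<rho> \<tau> R
          {x \<in> mspace X. mdist X x p \<in> {c..c + L}} \<Xi>"
        using near far \<Xi> B s
        by (auto simp: coarse_map_def mspace_scale_metric mdist_scale_metric)
      with True show ?thesis by blast
    next
      case False
      \<comment> \<open>The factor must be at least 1, so \<open>\<mu> * a powr c\<close> is too small. But then \<open>c\<close> is bounded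
        above, the whole slab has bounded diameter, and a constant map will do.\<close>
      have "log a (\<mu> * a powr c) < 0" using False a \<mu> by simp
      then have cle: "c < - log a \<mu>" using a \<mu> by (simp add: log_mult)
      have far: "mdist X x y \<le> R"
        if x: "x \<in> mspace X" and y: "y \<in> mspace X"
          and h: "mdist X x p \<in> {c..c + L}" "mdist X y p \<in> {c..c + L}" for x y
      proof -
        have "mdist X x y \<le> mdist X x p + mdist X y p"
          using mdist_triangle[OF x p y] by (simp add: mdist_commute)
        then have "mdist X x y \<le> 2 * (L - log a \<mu>)" using h cle by simp
        then show ?thesis by (simp add: R_def)
      qed
      have "\<Xi> p \<in> mspace B" using \<Xi>[OF p] B by simp
      moreover from this have "mdist B (\<Xi> p) (\<Xi> p) = 0" by simp
      then have "mdist B (\<Xi> p) (\<Xi> p) \<le> \<rho>" using \<rho> by linarith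
      ultimately have "coarse_map X (scale_metric 1 B) r \<rho> \<tau> R
          {x \<in> mspace X. mdist X x p \<in> {c..c + L}} (\<lambda>_. \<Xi> p)"
        using far \<rho> by (auto simp: coarse_map_def mspace_scale_metric mdist_scale_metric)
      then show ?thesis by blast
    qed
    then show "\<exists>R. \<forall>c. \<exists>s\<ge>1. \<exists>\<phi>. coarse_map X (scale_metric s B) r \<rho> \<tau> R
        {x \<in> mspace X. mdist X x p \<in> {c..c + L}} \<phi>" by blast
  qed
qed

lemma coarse_map_linf_prod:
  assumes "coarse_map X V r \<rho> \<tau> R A \<phi>" "coarse_map Y W r \<rho> \<tau> S B \<psi>"
  shows "coarse_map (linf_prod X Y) (linf_prod V W) r \<rho> \<tau> (max R S) (A \<times> B) (map_prod \<phi> \<psi>)"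
  using assms
  by (auto simp: coarse_map_def mspace_linf_prod mdist_linf_prod
      intro: max.coboundedI1 max.coboundedI2)

section \<open>Pulling back coloured coverings\<close>

lemma lebesgue_num_ballE:
  assumes "ennreal l \<le> lebesgue_num W \<U>" "z \<in> mspace W" "0 \<le> \<rho>" "\<rho> < l"
  obtains U where "U \<in> \<U>" "\<And>w. w \<in> mspace W \<Longrightarrow> mdist W z w \<le> \<rho> \<Longrightarrow> w \<in> U"
proof -
  have "ennreal \<rho> < ennreal l" using assms by (simp add: ennreal_lessI)
  also have "\<dots> \<le> (SUP U\<in>\<U>. INF w\<in>mspace W - U. ennreal (mdist W z w))"
    using assms(1,2) unfolding lebesgue_num_def by (meson INF_lower2 le_INF_iff order_trans)
  finally obtain U where U: "U \<in> \<U>" "ennreal \<rho> < (INF w\<in>mspace W - U. ennreal (mdist W z w))"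
    by (auto simp: less_SUP_iff)
  have "w \<in> U" if "w \<in> mspace W" "mdist W z w \<le> \<rho>" for w
  proof (rule ccontr)
    assume "w \<notin> U"
    then have "ennreal \<rho> < ennreal (mdist W z w)"
      using U(2) that by (meson DiffI INF_lower less_le_trans)
    then show False using that by (simp add: ennreal_less_iff assms)
  qed
  with U(1) show ?thesis using that by blast
qed

text \<open>The sets of a disjoint family may touch, but points with \<open>\<rho>\<close>-balls in different sets are more than
  \<open>\<rho>\<close> apart. Hence a chain cannot leave the set of the family in which it starts.\<close>

lemma components_bounded_pullback:
  assumes disj: "pairwise disjnt \<U>" and mesh: "mesh W \<U> \<le> ennreal \<tau>" and nn: "0 \<le> \<tau>" "0 \<le> \<rho>"
    and \<phi>: "coarse_map M W r \<rho> \<tau> R A \<phi>"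
  shows "components_bounded M r R
    {x \<in> A. \<exists>U\<in>\<U>. \<forall>w\<in>mspace W. mdist W (\<phi> x) w \<le> \<rho> \<longrightarrow> w \<in> U}" (is "components_bounded M r R ?C")
  unfolding components_bounded_def
proof (intro ballI allI impI)
  fix x y assume x: "x \<in> ?C" and xy: "(x, y) \<in> (steps M r ?C)\<^sup>*"
  then obtain U where U: "U \<in> \<U>" "\<And>w. w \<in> mspace W \<Longrightarrow> mdist W (\<phi> x) w \<le> \<rho> \<Longrightarrow> w \<in> U" by auto
  have \<phi>W: "\<phi> z \<in> mspace W" if "z \<in> A" for z
    using \<phi> that by (auto simp: coarse_map_def)
  have self: "mdist W (\<phi> z) (\<phi> z) \<le> \<rho>" if "z \<in> A" for z
  proof -
    have "mdist W (\<phi> z) (\<phi> z) = 0" using \<phi>W[OF that] by simp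
    then show ?thesis using nn by simp
  qed
  have "y \<in> A \<and> (\<forall>w\<in>mspace W. mdist W (\<phi> y) w \<le> \<rho> \<longrightarrow> w \<in> U)"
    using xy
  proof (induction rule: rtrancl_induct)
    case base
    then show ?case using x U by auto
  next
    case (step y z)
    then have z: "z \<in> A" "mdist M y z \<le> r" by (auto simp: steps_def)
    from step obtain V where V: "V \<in> \<U>" "\<And>w. w \<in> mspace W \<Longrightarrow> mdist W (\<phi> z) w \<le> \<rho> \<Longrightarrow> w \<in> V"
      by (auto simp: steps_def)
    have "mdist W (\<phi> y) (\<phi> z) \<le> \<rho>" using step.IH z \<phi> by (auto simp: coarse_map_def)
    then have "\<phi> z \<in> U" using step.IH z(1) \<phi>W by auto
    moreover have "\<phi> z \<in> V" using V(2) \<phi>W[OF z(1)] self[OF z(1)] by auto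
    ultimately have "U = V" using disj U(1) V(1) by (auto simp: pairwise_def disjnt_iff)
    then show ?case using V z by auto
  qed
  then have yA: "y \<in> A" "\<phi> y \<in> U" using \<phi>W self by auto
  have xA: "x \<in> A" "\<phi> x \<in> U" using x U(2) \<phi>W self by auto
  have "ennreal (mdist W (\<phi> x) (\<phi> y)) \<le> mesh W \<U>"
    unfolding mesh_def using U(1) xA yA
    by (intro SUP_upper2[of U] SUP_upper2[of "\<phi> x"] SUP_upper2[of "\<phi> y"]) auto
  also note mesh
  finally have "mdist W (\<phi> x) (\<phi> y) \<le> \<tau>" using nn by simp
  then show "mdist M x y \<le> R" using \<phi> xA yA by (auto simp: coarse_map_def)
qed

lemma colored_covering_pullback:
  assumes col: "colored (k + 1) \<U>" and mesh: "mesh W \<U> \<le> ennreal \<tau>"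
    and leb: "ennreal l \<le> lebesgue_num W \<U>" and \<rho>: "0 \<le> \<rho>" "\<rho> < l" and \<tau>: "0 \<le> \<tau>"
    and \<phi>: "coarse_map M W r \<rho> \<tau> R A \<phi>"
  shows "\<exists>C. A = (\<Union>i\<le>k. C i) \<and> (\<forall>i\<le>k. components_bounded M r R (C i))"
proof -
  obtain \<C> where \<C>: "\<And>i. i < k + 1 \<Longrightarrow> pairwise disjnt (\<C> i)" and \<U>: "\<U> = (\<Union>i<k + 1. \<C> i)"
    using col unfolding colored_def by blast
  define C where "C i = {x \<in> A. \<exists>U\<in>\<C> i. \<forall>w\<in>mspace W. mdist W (\<phi> x) w \<le> \<rho> \<longrightarrow> w \<in> U}" for i
  have "A \<subseteq> (\<Union>i\<le>k. C i)"
  proof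
    fix z assume z: "z \<in> A"
    then have "\<phi> z \<in> mspace W" using \<phi> by (auto simp: coarse_map_def)
    from lebesgue_num_ballE[OF leb this \<rho>]
    obtain U where U: "U \<in> \<U>" "\<And>w. w \<in> mspace W \<Longrightarrow> mdist W (\<phi> z) w \<le> \<rho> \<Longrightarrow> w \<in> U"
      by metis
    then obtain i where "i \<le> k" "U \<in> \<C> i" using \<U> by (auto simp: less_Suc_eq_le)
    then show "z \<in> (\<Union>i\<le>k. C i)" using U(2) z by (auto simp: C_def)
  qed
  moreover have "components_bounded M r R (C i)" if i: "i \<le> k" for i
  proof -
    have "mesh W (\<C> i) \<le> mesh W \<U>"
      unfolding mesh_def using i \<U> by (intro SUP_subset_mono) auto
    then show ?thesis
      unfolding C_def using \<C> i mesh \<tau> \<rho>(1) \<phi>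
      by (intro components_bounded_pullback[of _ W \<tau> \<rho>]) auto
  qed
  ultimately have "A = (\<Union>i\<le>k. C i) \<and> (\<forall>i\<le>k. components_bounded M r R (C i))"
    by (auto simp: C_def)
  then show ?thesis by blast
qed

section \<open>Products of visual hyperbolic spaces\<close>

theorem theorem1p1:
  fixes X1 :: "'a metric" and X2 :: "'b metric"
    and B1 :: "(nat \<Rightarrow> 'a) set metric" and B2 :: "(nat \<Rightarrow> 'b) set metric"
    and k :: nat
  assumes "visual_hyperbolic X1" and "visual_hyperbolic X2"
    and "visual_metric X1 B1" and "visual_metric X2 B2"
    and "uniform_ldim_le
           {linf_prod (scale_metric a B1) (scale_metric b B2) | a b. a \<ge> 1 \<and> b \<ge> 1} k"
  shows "asdim (linf_prod X1 X2) \<le> enat (k + 2)"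
proof -
  obtain p1 where p1: "p1 \<in> mspace X1" and shadow1:
    "\<And>L r \<rho> \<tau>. 0 < \<rho> \<Longrightarrow> 0 < \<tau> \<Longrightarrow> \<exists>R. \<forall>c. \<exists>s\<ge>1. \<exists>\<phi>.
       coarse_map X1 (scale_metric s B1) r \<rho> \<tau> R {x \<in> mspace X1. mdist X1 x p1 \<in> {c..c + L}} \<phi>"
    using shadow_maps_at_height[OF assms(1,3)] by blast
  obtain p2 where p2: "p2 \<in> mspace X2" and shadow2:
    "\<And>L r \<rho> \<tau>. 0 < \<rho> \<Longrightarrow> 0 < \<tau> \<Longrightarrow> \<exists>R. \<forall>c. \<exists>s\<ge>1. \<exists>\<phi>.
       coarse_map X2 (scale_metric s B2) r \<rho> \<tau> R {x \<in> mspace X2. mdist X2 x p2 \<in> {c..c + L}} \<phi>"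
    using shadow_maps_at_height[OF assms(2,4)] by blast
  define M where "M = linf_prod X1 X2"
  define h1 where "h1 z = mdist X1 (fst z) p1" for z :: "'a \<times> 'b"
  define h2 where "h2 z = mdist X2 (snd z) p2" for z :: "'a \<times> 'b"
  have mspace_M: "z \<in> mspace M \<longleftrightarrow> fst z \<in> mspace X1 \<and> snd z \<in> mspace X2" for z
    by (cases z) (simp add: M_def mspace_linf_prod)
  have mdist_M: "mdist M y z = max (mdist X1 (fst y) (fst z)) (mdist X2 (snd y) (snd z))" for y z
    by (simp add: M_def mdist_linf_prod case_prod_beta)
  have lip1: "\<bar>h1 y - h1 z\<bar> \<le> mdist M y z" if "y \<in> mspace M" "z \<in> mspace M" for y z
    using that p1 mdist_triangle[of "fst y" X1 "fst z" p1] mdist_triangle[of "fst z" X1 "fst y" p1]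
    by (auto simp: h1_def mdist_M mspace_M mdist_commute[of X1 "fst z" "fst y"])
  have lip2: "\<bar>h2 y - h2 z\<bar> \<le> mdist M y z" if "y \<in> mspace M" "z \<in> mspace M" for y z
    using that p2 mdist_triangle[of "snd y" X2 "snd z" p2] mdist_triangle[of "snd z" X2 "snd y" p2]
    by (auto simp: h2_def mdist_M mspace_M mdist_commute[of X2 "snd z" "snd y"])

  let ?\<W> = "{linf_prod (scale_metric a B1) (scale_metric b B2) | a b. a \<ge> 1 \<and> b \<ge> 1}"
  obtain \<delta> where \<delta>: "0 < \<delta>" and ev: "\<forall>\<^sub>F \<tau> in at_right 0. \<forall>W\<in>?\<W>. \<exists>\<U>. open_covering W \<U> \<and>
      colored (k + 1) \<U> \<and> mesh W \<U> \<le> ennreal \<tau> \<and> lebesgue_num W \<U> \<ge> ennreal (\<delta> * \<tau>)"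
    using assms(5) unfolding uniform_ldim_le_def by blast
  have "\<forall>\<^sub>F \<tau>::real in at_right 0. 0 < \<tau>" by (simp add: eventually_at_right_less)
  from eventually_happens[OF eventually_conj[OF this ev]]
  obtain \<tau> where \<tau>: "0 < \<tau>" and cover: "\<forall>W\<in>?\<W>. \<exists>\<U>. open_covering W \<U> \<and>
      colored (k + 1) \<U> \<and> mesh W \<U> \<le> ennreal \<tau> \<and> lebesgue_num W \<U> \<ge> ennreal (\<delta> * \<tau>)"
    by (meson trivial_limit_at_right_real)
  \<comment> \<open>One mesh size \<open>\<tau>\<close> serves all scales \<open>r\<close>: the shadow maps bring \<open>r\<close> down to \<open>\<rho>\<close>.\<close>
  define \<rho> where "\<rho> = \<delta> * \<tau> / 2"
  have \<rho>: "0 < \<rho>" "\<rho> < \<delta> * \<tau>" using \<delta> \<tau> by (simp_all add: \<rho>_def)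

  have window: "uniform_asdim_le M
      {{z \<in> E. h2 z \<in> {c..c + L2}} | E c. E \<in> {{z \<in> E. h1 z \<in> {c..c + L1}} | E c. E \<in> {mspace M}}} k"
    for L1 L2
    unfolding uniform_asdim_le_def
  proof (intro allI impI)
    fix r :: real assume "r > 0"
    obtain R1 where R1: "\<And>c. \<exists>s\<ge>1. \<exists>\<phi>. coarse_map X1 (scale_metric s B1) r \<rho> \<tau> R1
        {x \<in> mspace X1. mdist X1 x p1 \<in> {c..c + L1}} \<phi>"
      using shadow1[OF \<rho>(1) \<tau>, of r L1] by blast
    obtain R2 where R2: "\<And>c. \<exists>s\<ge>1. \<exists>\<phi>. coarse_map X2 (scale_metric s B2) r \<rho> \<tau> R2
        {x \<in> mspace X2. mdist X2 x p2 \<in> {c..c + L2}} \<phi>"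
      using shadow2[OF \<rho>(1) \<tau>, of r L2] by blast
    show "\<exists>R. \<forall>A\<in>{{z \<in> E. h2 z \<in> {c..c + L2}} | E c.
          E \<in> {{z \<in> E. h1 z \<in> {c..c + L1}} | E c. E \<in> {mspace M}}}.
        \<exists>C. A = (\<Union>i\<le>k. C i) \<and> (\<forall>i\<le>k. components_bounded M r R (C i))"
    proof (intro exI[of _ "max R1 R2"] ballI)
      fix A assume "A \<in> {{z \<in> E. h2 z \<in> {c..c + L2}} | E c.
          E \<in> {{z \<in> E. h1 z \<in> {c..c + L1}} | E c. E \<in> {mspace M}}}"
      then obtain c d where "A = {z \<in> mspace M. h1 z \<in> {c..c + L1} \<and> h2 z \<in> {d..d + L2}}"
        by auto
      then have A: "A = {x \<in> mspace X1. mdist X1 x p1 \<in> {c..c + L1}} \<times>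
          {x \<in> mspace X2. mdist X2 x p2 \<in> {d..d + L2}}"
        by (auto simp: M_def mspace_linf_prod h1_def h2_def)
      obtain s \<phi> where s: "1 \<le> s" "coarse_map X1 (scale_metric s B1) r \<rho> \<tau> R1
          {x \<in> mspace X1. mdist X1 x p1 \<in> {c..c + L1}} \<phi>"
        using R1 by blast
      obtain t \<psi> where t: "1 \<le> t" "coarse_map X2 (scale_metric t B2) r \<rho> \<tau> R2
          {x \<in> mspace X2. mdist X2 x p2 \<in> {d..d + L2}} \<psi>"
        using R2 by blast
      let ?W = "linf_prod (scale_metric s B1) (scale_metric t B2)"
      have "coarse_map M ?W r \<rho> \<tau> (max R1 R2) A (map_prod \<phi> \<psi>)"
        unfolding M_def A using s(2) t(2) by (rule coarse_map_linf_prod)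
      moreover obtain \<U> where "colored (k + 1) \<U>" "mesh ?W \<U> \<le> ennreal \<tau>"
        "lebesgue_num ?W \<U> \<ge> ennreal (\<delta> * \<tau>)"
        using cover s(1) t(1) by blast
      ultimately show "\<exists>C. A = (\<Union>i\<le>k. C i) \<and>
          (\<forall>i\<le>k. components_bounded M r (max R1 R2) (C i))"
        using \<rho> \<tau> by (intro colored_covering_pullback) auto
    qed
  qed
  have "uniform_asdim_le M {{z \<in> E. h1 z \<in> {c..c + L}} | E c. E \<in> {mspace M}} (Suc k)" for L
    by (rule uniform_asdim_le_fibration[OF _ lip2 window]) auto
  from uniform_asdim_le_fibration[OF _ lip1 this]
  have "uniform_asdim_le M {mspace M} (Suc (Suc k))" by auto
  then have "asdim M \<le> enat (Suc (Suc k))" by (rule asdim_le_of_uniform_asdim_le)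
  then show ?thesis by (simp add: M_def)
qed

end
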